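(* Let $n$ be a positive real number. If $h:=h'_{2,n/2}$ and $A:=A_{1,n}$, then $$4(A^4+1)h^8=A^4.$$
   Context: For $|q|<1$, $\varphi(q)=\sum_{m=-\infty}^{\infty}q^{m^2}$ and $\psi(q)=\sum_{m=0}^{\infty}q^{m(m+1)/2}$. For positive real $k,n$ define $$h'_{k,n}=\frac{\varphi(-q)}{k^{1/4}\varphi(-q^k)}\ \text{ with } q=e^{-2\pi\sqrt{n/k}},\qquad A_{k,n}=\frac{\varphi(-q)}{2k^{1/4}q^{k/4}\psi(q^{2k})}\ \text{ with } q=e^{-\pi\sqrt{n/k}}.$$ *)

theory Defs
  imports "HOL-Analysis.Analysis"
begin

text \<open>Ramanujan's theta functions \<open>\<phi>\<close> and \<open>\<psi>\<close>; the defining series converge, and the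
  definitions are meaningful, for \<open>norm q < 1\<close>.\<close>

definition ramanujan_phi :: "'a :: {real_normed_field, banach} \<Rightarrow> 'a" where
  "ramanujan_phi q = (\<Sum>\<^sub>\<infinity>m::int. q powi (m ^ 2))"

definition ramanujan_psi :: "'a :: {real_normed_field, banach} \<Rightarrow> 'a" where
  "ramanujan_psi q = (\<Sum>m::nat. q ^ (m * (m + 1) div 2))"

text \<open>Both quantities below are meant for positive real \<open>k\<close> and \<open>n\<close>; then \<open>0 < q < 1\<close>, so
  the real powers of \<open>q\<close> are the ordinary ones.\<close>

definition theta_h' :: "real \<Rightarrow> real \<Rightarrow> real" where
  "theta_h' k n =
     (let q = exp (- 2 * pi * sqrt (n / k))
      in ramanujan_phi (- q) / (k powr (1 / 4) * ramanujan_phi (- (q powr k))))"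

definition theta_A :: "real \<Rightarrow> real \<Rightarrow> real" where
  "theta_A k n =
     (let q = exp (- pi * sqrt (n / k))
      in ramanujan_phi (- q) /
           (2 * k powr (1 / 4) * q powr (k / 4) * ramanujan_psi (q powr (2 * k))))"

end

theory Submission imports Defs begin

text \<open>
  Both quantities involve the same nome \<open>q = exp (- pi * sqrt n)\<close>. Jacobi's identity
  \<open>\<phi>(q)\<^sup>4 - \<phi>(-q)\<^sup>4 = 16 q \<psi>(q\<^sup>2)\<^sup>4\<close> turns \<open>A\<^sup>4 + 1\<close> into
  \<open>\<phi>(q)\<^sup>4 / (16 q \<psi>(q\<^sup>2)\<^sup>4)\<close>, and \<open>\<phi>(q) \<phi>(-q) = \<phi>(-q\<^sup>2)\<^sup>2\<close> turns \<open>4 h\<^sup>8\<close> into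
  \<open>\<phi>(-q)\<^sup>4 / \<phi>(q)\<^sup>4\<close>. All theta identities come from splitting a sum over the lattice of
  integer pairs \<open>(m, n)\<close> by the parity of \<open>m + n\<close>, with \<open>(m, n) = (a + b, a - b)\<close> on the even part
  and \<open>(m, n) = (a + b + 1, a - b)\<close> on the odd part.
\<close>

section \<open>Sums over products, integers and integer pairs\<close>

lemma product_abs_summable_infsum:
  fixes f g :: "_ \<Rightarrow> 'c::{real_normed_field,banach}"
  assumes f: "f abs_summable_on A" and g: "g abs_summable_on B"
  shows "(\<lambda>(x, y). f x * g y) summable_on A \<times> B"
    and "(\<Sum>\<^sub>\<infinity>(x, y)\<in>A \<times> B. f x * g y) = infsum f A * infsum g B"
proof -
  have "(\<lambda>(x, y). f x * g y) abs_summable_on A \<times> B"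
    unfolding Infinite_Sum.abs_summable_on_Sigma_iff
    using f g by (simp add: norm_mult summable_on_cmult_right infsum_cmult_right'
        summable_on_cmult_left abs_mult infsum_nonneg)
  then show s: "(\<lambda>(x, y). f x * g y) summable_on A \<times> B"
    by (rule abs_summable_summable)
  show "(\<Sum>\<^sub>\<infinity>(x, y)\<in>A \<times> B. f x * g y) = infsum f A * infsum g B"
    using infsum_Sigma'_banach[OF s] by (simp add: infsum_cmult_right' infsum_cmult_left')
qed

text \<open>Indexing the negative half by \<open>- 1 - int n\<close> pairs the two halves under
  \<open>m \<mapsto> - 1 - m\<close>, the symmetry of the triangular numbers.\<close>

lemma infsum_int_split:
  fixes f :: "int \<Rightarrow> 'a::{t2_space,topological_comm_monoid_add}"
  assumes "(\<lambda>n. f (int n)) summable_on UNIV" "(\<lambda>n. f (- 1 - int n)) summable_on UNIV"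
  shows "f summable_on UNIV"
    and "infsum f UNIV = (\<Sum>\<^sub>\<infinity>n. f (int n)) + (\<Sum>\<^sub>\<infinity>n. f (- 1 - int n))"
proof -
  have bp: "bij_betw int UNIV {0..}"
    by (rule bij_betwI[where g = nat]) auto
  have bn: "bij_betw (\<lambda>n. - 1 - int n) UNIV {..<0}"
    by (rule bij_betwI[where g = "\<lambda>m. nat (- 1 - m)"]) auto
  have s: "f summable_on {0..}" "f summable_on {..<0}"
    using assms summable_on_reindex_bij_betw[OF bp, of f] summable_on_reindex_bij_betw[OF bn, of f]
    by auto
  have d: "{0..} \<inter> {..<0::int} = {}" "{0..} \<union> {..<0::int} = UNIV" by auto
  show "f summable_on UNIV"
    using summable_on_Un_disjoint[OF s d(1)] by (simp add: d(2))
  show "infsum f UNIV = (\<Sum>\<^sub>\<infinity>n. f (int n)) + (\<Sum>\<^sub>\<infinity>n. f (- 1 - int n))"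
    using infsum_Un_disjoint[OF s d(1)]
    by (simp add: d(2) infsum_reindex_bij_betw[OF bp] infsum_reindex_bij_betw[OF bn])
qed

lemma infsum_int_pairs_parity:
  fixes F :: "int \<Rightarrow> int \<Rightarrow> 'a::banach"
  assumes "(\<lambda>(m, n). F m n) summable_on UNIV"
  shows "(\<Sum>\<^sub>\<infinity>(m, n). F m n) =
      (\<Sum>\<^sub>\<infinity>(a, b). F (a + b) (a - b)) + (\<Sum>\<^sub>\<infinity>(a, b). F (a + b + 1) (a - b))"
proof -
  let ?E = "{p::int \<times> int. even (fst p + snd p)}" and ?O = "{p::int \<times> int. odd (fst p + snd p)}"
  let ?F = "\<lambda>p. F (fst p) (snd p)"
  have be: "bij_betw (\<lambda>(a, b). (a + b, a - b)) UNIV ?E"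
    by (rule bij_betwI[where g = "\<lambda>(m, n). ((m + n) div 2, (m - n) div 2)"])
      (auto elim!: evenE oddE, presburger+)
  \<comment> \<open>On the odd part \<open>m + n - 1 = 2 * a\<close> and
    \<open>m - n - 1 = 2 * b\<close>, so both divisions in the inverse are exact.\<close>
  have bo: "bij_betw (\<lambda>(a, b). (a + b + 1, a - b)) UNIV ?O"
    by (rule bij_betwI[where g = "\<lambda>(m, n). ((m + n - 1) div 2, (m - n - 1) div 2)"])
      (auto elim!: evenE oddE, presburger+)
  have F: "?F summable_on UNIV" using assms by (simp add: case_prod_beta')
  have s: "?F summable_on ?E" "?F summable_on ?O"
    by (rule summable_on_subset_banach[OF F], simp)+
  have d: "?E \<inter> ?O = {}" "?E \<union> ?O = UNIV" by auto
  show "(\<Sum>\<^sub>\<infinity>(m, n). F m n) =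
      (\<Sum>\<^sub>\<infinity>(a, b). F (a + b) (a - b)) + (\<Sum>\<^sub>\<infinity>(a, b). F (a + b + 1) (a - b))"
    using infsum_Un_disjoint[OF s d(1), unfolded d(2)] infsum_reindex_bij_betw[OF be, of ?F]
      infsum_reindex_bij_betw[OF bo, of ?F]
    by (simp add: case_prod_beta')
qed

section \<open>Convergence and the two-sided form of psi\<close>

text \<open>Summing over all integers lets the changes of variables on the pair lattice act as
  bijections, which the one-sided series for psi does not allow.\<close>

definition psi_bilateral :: "'a :: {real_normed_field, banach} \<Rightarrow> 'a" where
  "psi_bilateral q = (\<Sum>\<^sub>\<infinity>m::int. q powi (m * (m + 1) div 2))"

context
  fixes q :: "'a :: {real_normed_field, banach}"
  assumes q: "norm q < 1"
begin

text \<open>Comparison with a geometric series. The slack of 1 is what triangular exponents require: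
  at \<open>m = -2\<close> the exponent is only 1.\<close>

lemma abs_summable_powi:
  assumes "\<And>m::int. \<bar>m\<bar> \<le> e m + 1"
  shows "(\<lambda>m::int. q powi e m) abs_summable_on UNIV"
proof (rule infsum_int_split(1))
  have *: "(\<lambda>n. norm (q powi e (h n))) summable_on UNIV"
    if h: "\<And>n. int n \<le> \<bar>h n\<bar>" for h :: "nat \<Rightarrow> int"
  proof (rule norm_summable_imp_summable_on, rule summable_comparison_test')
    show "summable (\<lambda>n. norm q ^ (n - 1))"
      using summable_Suc_iff[of "\<lambda>n. norm q ^ (n - 1)"] q by (simp add: summable_geometric)
    \<comment> \<open>Index 0 is left out because the hypothesis allows
      \<open>e 0 = -1\<close>.\<close>
    fix n :: nat assume "n \<ge> 1"
    then have e: "e (h n) \<ge> 0" "n - 1 \<le> nat (e (h n))" using assms[of "h n"] h[of n] by auto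
    show "norm (norm (norm (q powi e (h n)))) \<le> norm q ^ (n - 1)"
      using e q by (simp add: power_int_nonneg_exp norm_power power_decreasing)
  qed
  show "(\<lambda>n. norm (q powi e (int n))) summable_on UNIV"
    "(\<lambda>n. norm (q powi e (- 1 - int n))) summable_on UNIV"
    by (auto intro!: *)
qed

lemma abs_summable_phi: "(\<lambda>m::int. q powi m\<^sup>2) abs_summable_on UNIV"
proof (rule abs_summable_powi)
  fix m :: int
  show "\<bar>m\<bar> \<le> m\<^sup>2 + 1"
    using zero_le_power2[of "\<bar>m\<bar> - 1"] by (simp add: power2_diff)
qed

lemma abs_summable_psi_bilateral: "(\<lambda>m::int. q powi (m * (m + 1) div 2)) abs_summable_on UNIV"
proof (rule abs_summable_powi)
  fix m :: int
  \<comment> \<open>A product of consecutive integers is nonnegative; expanded, it reads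
    \<open>2 * (\<bar>m\<bar> - 1) \<le> m^2 - \<bar>m\<bar>\<close>, and the right side is at most
    \<open>m * (m + 1)\<close>.\<close>
  have "0 \<le> (\<bar>m\<bar> - 1) * (\<bar>m\<bar> - 2)"
    by (cases "\<bar>m\<bar> \<le> 1") (auto intro: mult_nonneg_nonneg mult_nonpos_nonpos)
  then have "2 * (\<bar>m\<bar> - 1) \<le> m * (m + 1)" by (cases "m \<ge> 0") (auto simp: algebra_simps)
  from zdiv_mono1[OF this, of 2] show "\<bar>m\<bar> \<le> m * (m + 1) div 2 + 1" by simp
qed

text \<open>The exponent is invariant under \<open>m \<mapsto> - 1 - m\<close>, which exchanges the
  nonnegative and the negative integers.\<close>

lemma psi_bilateral_eq: "psi_bilateral q = 2 * ramanujan_psi q"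
proof -
  let ?t = "\<lambda>m::int. q powi (m * (m + 1) div 2)"
  have pos: "?t (int n) = q ^ (n * (n + 1) div 2)" for n
  proof -
    have "int n * (int n + 1) div 2 = int (n * (n + 1) div 2)" by (simp add: zdiv_int algebra_simps)
    then show ?thesis by (simp only: power_int_of_nat)
  qed
  have neg: "?t (- 1 - int n) = ?t (int n)" for n by (simp add: algebra_simps)
  have "(?t \<circ> int) abs_summable_on UNIV"
    using summable_on_subset_banach[OF abs_summable_psi_bilateral, of "range int"]
    by (simp add: summable_on_reindex o_def)
  then have n: "(\<lambda>n. ?t (int n)) abs_summable_on UNIV" by simp
  then have s: "(\<lambda>n. ?t (int n)) summable_on UNIV" by (rule abs_summable_summable)
  have "ramanujan_psi q = (\<Sum>\<^sub>\<infinity>n. ?t (int n))"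
    using sums_unique[OF has_sum_imp_sums[OF has_sum_infsum[OF s]]]
    by (simp only: pos ramanujan_psi_def)
  moreover have "infsum ?t UNIV = (\<Sum>\<^sub>\<infinity>n. ?t (int n)) + (\<Sum>\<^sub>\<infinity>n. ?t (- 1 - int n))"
    by (rule infsum_int_split(2)) (use s neg in simp_all)
  ultimately show ?thesis by (simp only: psi_bilateral_def neg mult_2)
qed

end

section \<open>Quadratic theta identities and Jacobi's quartic identity\<close>

lemma powi_sum_diff_squares:
  fixes q :: "'a :: field"
  assumes "q \<noteq> 0"
  shows "q powi (a + b)\<^sup>2 * q powi (a - b)\<^sup>2 = (q\<^sup>2) powi a\<^sup>2 * (q\<^sup>2) powi b\<^sup>2"
proof -
  have "(a + b)\<^sup>2 + (a - b)\<^sup>2 = 2 * a\<^sup>2 + 2 * b\<^sup>2"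
    by (simp add: power2_eq_square algebra_simps)
  then show ?thesis using assms by (simp add: power_int_power flip: power_int_add)
qed

lemma phi_times_phi_minus:
  fixes q :: "'a :: {real_normed_field, banach}"
  assumes q: "norm q < 1" "q \<noteq> 0"
  shows "ramanujan_phi q * ramanujan_phi (- q) = (ramanujan_phi (- q\<^sup>2))\<^sup>2"
proof -
  have q2: "norm (- q\<^sup>2) < 1" using q by (simp add: norm_power power_less_one_iff)
  define F where "F = (\<lambda>m n::int. q powi m\<^sup>2 * (- q) powi n\<^sup>2)"
  have S: "(\<lambda>(m, n). F m n) summable_on UNIV"
      "(\<Sum>\<^sub>\<infinity>(m, n). F m n) = ramanujan_phi q * ramanujan_phi (- q)"
    using product_abs_summable_infsum[OF abs_summable_phi abs_summable_phi, of q "- q"] q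
    by (simp_all add: F_def ramanujan_phi_def)
  \<comment> \<open>The sign is \<open>(-1)^(a - b) = (-1)^a * (-1)^b\<close>, and squares keep
    parity, so it is absorbed by replacing \<open>q^2\<close> with \<open>- q^2\<close>.\<close>
  have "F (a + b) (a - b) = (- q\<^sup>2) powi a\<^sup>2 * (- q\<^sup>2) powi b\<^sup>2" for a b
    using q(2) powi_sum_diff_squares[of q a b]
    by (auto simp: F_def power_int_minus_left)
  then have even: "(\<Sum>\<^sub>\<infinity>(a, b). F (a + b) (a - b)) = (ramanujan_phi (- q\<^sup>2))\<^sup>2"
    using product_abs_summable_infsum(2)[OF abs_summable_phi abs_summable_phi, OF q2 q2]
    by (simp add: ramanujan_phi_def power2_eq_square[of "infsum _ _"])
  let ?G = "\<lambda>(a, b). F (a + b + 1) (a - b)"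
  \<comment> \<open>The substitution \<open>b \<mapsto> - 1 - b\<close> interchanges the two arguments of \<open>F\<close>, which have
    opposite parity here, so it changes the sign and the odd part vanishes.\<close>
  have bij: "bij_betw (\<lambda>(a, b). (a, - 1 - b)) UNIV (UNIV :: (int \<times> int) set)"
    by (rule bij_betwI[where g = "\<lambda>(a, b). (a, - 1 - b)"]) auto
  have "?G (case p of (a, b) \<Rightarrow> (a, - 1 - b)) = - ?G p" for p
  proof (cases p)
    case (Pair a b)
    show ?thesis by (auto simp: Pair F_def power_int_minus_left algebra_simps)
  qed
  then have "infsum ?G UNIV = - infsum ?G UNIV"
    using infsum_reindex_bij_betw[OF bij, of ?G] by (simp add: infsum_uminus)
  then have "infsum ?G UNIV = 0"
    by simp
  then show ?thesis
    using infsum_int_pairs_parity[OF S(1)] S(2) even by simp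
qed

text \<open>With \<open>T\<close> for triangular numbers, the odd part has exponent
  \<open>1 + 4 * T a + 4 * T b\<close>. Replacing \<open>q\<close> by \<open>- q\<close> flips the
  sign of the last term only, which prepares a difference of squares.\<close>

lemma phi_squared_split:
  fixes q :: "'a :: {real_normed_field, banach}"
  assumes q: "norm q < 1" "q \<noteq> 0"
  shows "(ramanujan_phi q)\<^sup>2 = (ramanujan_phi (q\<^sup>2))\<^sup>2 + q * (psi_bilateral (q ^ 4))\<^sup>2"
proof -
  have q2: "norm (q\<^sup>2) < 1" "norm (q ^ 4) < 1" using q by (simp_all add: norm_power power_less_one_iff)
  define F where "F = (\<lambda>m n::int. q powi m\<^sup>2 * q powi n\<^sup>2)"
  have S: "(\<lambda>(m, n). F m n) summable_on UNIV"
      "(\<Sum>\<^sub>\<infinity>(m, n). F m n) = (ramanujan_phi q)\<^sup>2"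
    using product_abs_summable_infsum[OF abs_summable_phi abs_summable_phi, of q q] q
    by (simp_all add: F_def ramanujan_phi_def power2_eq_square[of "infsum _ _"])
  have "F (a + b) (a - b) = (q\<^sup>2) powi a\<^sup>2 * (q\<^sup>2) powi b\<^sup>2" for a b
    using powi_sum_diff_squares[OF q(2)] by (simp add: F_def)
  then have even: "(\<Sum>\<^sub>\<infinity>(a, b). F (a + b) (a - b)) = (ramanujan_phi (q\<^sup>2))\<^sup>2"
    using product_abs_summable_infsum(2)[OF abs_summable_phi abs_summable_phi, OF q2(1) q2(1)]
    by (simp add: ramanujan_phi_def power2_eq_square[of "infsum _ _"])
  have "F (a + b + 1) (a - b) =
      q * ((q ^ 4) powi (a * (a + 1) div 2) * (q ^ 4) powi (b * (b + 1) div 2))" for a b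
  proof -
    have "(a + b + 1)\<^sup>2 + (a - b)\<^sup>2 = 1 + (4 * (a * (a + 1) div 2) + 4 * (b * (b + 1) div 2))"
    proof -
      have "even (a * (a + 1))" "even (b * (b + 1))" by auto
      then obtain x y where "a * (a + 1) = 2 * x" "b * (b + 1) = 2 * y" by (elim evenE)
      then show ?thesis by (simp add: power2_eq_square algebra_simps)
    qed
    moreover have "F (a + b + 1) (a - b) = q powi ((a + b + 1)\<^sup>2 + (a - b)\<^sup>2)"
      using q(2) by (simp add: F_def power_int_add)
    ultimately show ?thesis using q(2) by (simp add: power_int_power power_int_add)
  qed
  then have "(\<Sum>\<^sub>\<infinity>(a, b). F (a + b + 1) (a - b)) = q * (psi_bilateral (q ^ 4))\<^sup>2"
    using product_abs_summable_infsum(2)[OF abs_summable_psi_bilateral abs_summable_psi_bilateral,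
        OF q2(2) q2(2)]
    by (simp add: psi_bilateral_def power2_eq_square case_prod_beta' infsum_cmult_right')
  then show ?thesis
    using infsum_int_pairs_parity[OF S(1)] S(2) even by simp
qed

text \<open>With \<open>T\<close> for triangular numbers, the exponent is
  \<open>2 * T a + b^2\<close> on the even part and \<open>2 * T b + (a + 1)^2\<close> on the odd
  part. The two parts have equal sums, whence the factor 2.\<close>

lemma psi_bilateral_squared:
  fixes q :: "'a :: {real_normed_field, banach}"
  assumes q: "norm q < 1" "q \<noteq> 0"
  shows "(psi_bilateral q)\<^sup>2 = 2 * ramanujan_phi q * psi_bilateral (q\<^sup>2)"
proof -
  have q2: "norm (q\<^sup>2) < 1" using q by (simp add: norm_power power_less_one_iff)
  define F where "F = (\<lambda>m n::int. q powi (m * (m + 1) div 2) * q powi (n * (n + 1) div 2))"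
  define G where "G = (\<lambda>a b::int. (q\<^sup>2) powi (a * (a + 1) div 2) * q powi b\<^sup>2)"
  have S: "(\<lambda>(m, n). F m n) summable_on UNIV"
      "(\<Sum>\<^sub>\<infinity>(m, n). F m n) = (psi_bilateral q)\<^sup>2"
    using product_abs_summable_infsum[OF abs_summable_psi_bilateral abs_summable_psi_bilateral,
        of q q] q
    by (simp_all add: F_def psi_bilateral_def power2_eq_square[of "infsum _ _"])
  have G: "(\<Sum>\<^sub>\<infinity>(a, b). G a b) = ramanujan_phi q * psi_bilateral (q\<^sup>2)"
    using product_abs_summable_infsum(2)[OF abs_summable_psi_bilateral abs_summable_phi,
        OF q2 q(1)]
    by (simp add: G_def ramanujan_phi_def psi_bilateral_def mult.commute)
  have even: "F (a + b) (a - b) = G a b" for a b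
  proof -
    have "even ((a + b) * (a + b + 1))" "even ((a - b) * (a - b + 1))" "even (a * (a + 1))"
      by auto
    then obtain x y z where xyz: "(a + b) * (a + b + 1) = 2 * x"
      "(a - b) * (a - b + 1) = 2 * y" "a * (a + 1) = 2 * z"
      by (elim evenE)
    then have "x + y = 2 * z + b\<^sup>2" by (simp add: power2_eq_square algebra_simps)
    then show ?thesis using q(2) by (simp add: F_def G_def xyz power_int_power flip: power_int_add)
  qed
  have odd: "F (a + b + 1) (a - b) = G b (a + 1)" for a b
  proof -
    have "even ((a + b + 1) * (2 + (a + b)))" "even ((a - b) * (a - b + 1))" "even (b * (b + 1))"
      by auto
    then obtain x y z where xyz: "(a + b + 1) * (2 + (a + b)) = 2 * x"
      "(a - b) * (a - b + 1) = 2 * y" "b * (b + 1) = 2 * z"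
      by (elim evenE)
    then have "x + y = 2 * z + (a + 1)\<^sup>2" by (simp add: power2_eq_square algebra_simps)
    then show ?thesis using q(2) by (simp add: F_def G_def xyz power_int_power flip: power_int_add)
  qed
  have bij: "bij_betw (\<lambda>(a, b). (b, a + 1)) UNIV (UNIV :: (int \<times> int) set)"
    by (rule bij_betwI[where g = "\<lambda>(a, b). (b - 1, a)"]) auto
  have "(\<Sum>\<^sub>\<infinity>(a, b). G b (a + 1)) = (\<Sum>\<^sub>\<infinity>(a, b). G a b)"
    using infsum_reindex_bij_betw[OF bij, of "\<lambda>(a, b). G a b"] by (simp add: case_prod_beta')
  then show ?thesis
    using infsum_int_pairs_parity[OF S(1)] S(2) G by (simp add: even odd)
qed

lemma jacobi_phi_psi:
  fixes q :: "'a :: {real_normed_field, banach}"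
  assumes q: "norm q < 1" "q \<noteq> 0"
  shows "ramanujan_phi q ^ 4 - ramanujan_phi (- q) ^ 4 = 16 * q * ramanujan_psi (q\<^sup>2) ^ 4"
proof -
  have q2: "norm (q\<^sup>2) < 1" using q by (simp add: norm_power power_less_one_iff)
  define P where "P = ramanujan_phi (q\<^sup>2)"
  define R where "R = psi_bilateral (q ^ 4)"
  have plus: "(ramanujan_phi q)\<^sup>2 = P\<^sup>2 + q * R\<^sup>2"
    and minus: "(ramanujan_phi (- q))\<^sup>2 = P\<^sup>2 - q * R\<^sup>2"
    using phi_squared_split[of q] phi_squared_split[of "- q"] q by (simp_all add: P_def R_def)
  \<comment> \<open>Both sides equal \<open>(psi_bilateral (q^2))^2\<close>, which links
    \<open>P * R\<close> to psi at \<open>q^2\<close>.\<close>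
  have *: "4 * (ramanujan_psi (q\<^sup>2))\<^sup>2 = 2 * P * R"
    using psi_bilateral_squared[of "q\<^sup>2"] q q2
    by (simp add: P_def R_def psi_bilateral_eq power_mult_distrib flip: power_mult)
  have "ramanujan_phi q ^ 4 - ramanujan_phi (- q) ^ 4
      = ((ramanujan_phi q)\<^sup>2)\<^sup>2 - ((ramanujan_phi (- q))\<^sup>2)\<^sup>2"
    by (simp flip: power_mult)
  \<comment> \<open>The sum and the difference of the two squares are \<open>2 * P^2\<close> and
    \<open>2 * q * R^2\<close>.\<close>
  also have "\<dots> = q * (2 * P * R)\<^sup>2"
    unfolding plus minus by (simp add: power2_eq_square algebra_simps)
  also have "\<dots> = 16 * q * ramanujan_psi (q\<^sup>2) ^ 4"
    by (simp add: power_mult_distrib flip: * power_mult)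
  finally show ?thesis .
qed

section \<open>Elimination, positivity and specialization to the nome\<close>

text \<open>Here \<open>a\<close>, \<open>b\<close>, \<open>c\<close> stand for phi at
  \<open>q\<close>, \<open>- q\<close>, \<open>- q^2\<close> and \<open>s\<close> for psi at
  \<open>q^2\<close>; the two fractions are \<open>A^4\<close> and \<open>h^8\<close>.\<close>

lemma theta_h'_theta_A_identity:
  fixes a b c s q :: real
  assumes "a * b = c\<^sup>2" "a ^ 4 - b ^ 4 = 16 * q * s ^ 4" "q > 0" "s \<noteq> 0" "a \<noteq> 0"
  shows "4 * (b ^ 4 / (16 * q * s ^ 4) + 1) * (b ^ 8 / (4 * c ^ 8)) = b ^ 4 / (16 * q * s ^ 4)"
\<comment> \<open>For \<open>b = 0\<close> both sides vanish; otherwise \<open>a^4 * b^4\<close>,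
  the value of \<open>c^8\<close>, can be cancelled.\<close>
proof (cases "b = 0")
  case False
  have c: "c ^ 8 = a ^ 4 * b ^ 4"
    using arg_cong[OF assms(1), of "\<lambda>x. x ^ 4"] by (simp add: power_mult_distrib)
  have "b ^ 4 / (16 * q * s ^ 4) + 1 = a ^ 4 / (16 * q * s ^ 4)"
    using assms by (simp add: field_simps)
  moreover have "b ^ 8 = b ^ 4 * b ^ 4" by (simp flip: power_add)
  ultimately have "4 * (b ^ 4 / (16 * q * s ^ 4) + 1) * (b ^ 8 / (4 * c ^ 8))
      = 4 * (a ^ 4 / (16 * q * s ^ 4)) * (b ^ 4 * b ^ 4 / (4 * (a ^ 4 * b ^ 4)))"
    by (simp only: c)
  also have "\<dots> = b ^ 4 / (16 * q * s ^ 4)"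
  proof -
    have cancel: "4 * (x / d) * (y * y / (4 * (x * y))) = y / d" if "x \<noteq> 0" "y \<noteq> 0" for x y d :: real
      using that by simp
    show ?thesis by (rule cancel) (use False assms(5) in simp_all)
  qed
  finally show ?thesis .
qed auto

lemma
  fixes q :: real
  assumes "0 < q" "q < 1"
  shows ramanujan_phi_pos: "ramanujan_phi q > 0"
    and ramanujan_psi_pos: "ramanujan_psi q > 0"
proof -
  have *: "(\<Sum>\<^sub>\<infinity>m::int. q powi e m) > 0" if "(\<lambda>m. q powi e m) summable_on UNIV" for e
  proof -
    \<comment> \<open>All terms are positive, so the sum is at least its term at 0.\<close>
    have "infsum (\<lambda>m. q powi e m) {0} \<le> (\<Sum>\<^sub>\<infinity>m. q powi e m)"
      by (rule infsum_mono_neutral) (use that assms in auto)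
    moreover have "infsum (\<lambda>m. q powi e m) {0} = q powi e 0"
      by simp
    ultimately show ?thesis using zero_less_power_int[OF assms(1), of "e 0"] by linarith
  qed
  show "ramanujan_phi q > 0"
    unfolding ramanujan_phi_def using assms by (intro *[OF abs_summable_summable[OF abs_summable_phi]]) simp
  have "psi_bilateral q > 0"
    unfolding psi_bilateral_def using assms
    by (intro *[OF abs_summable_summable[OF abs_summable_psi_bilateral]]) simp
  then show "ramanujan_psi q > 0" using assms by (simp add: psi_bilateral_eq)
qed

theorem theorem6p3:
  fixes n :: real
  assumes "n > 0"
  shows "4 * ((theta_A 1 n) ^ 4 + 1) * (theta_h' 2 (n / 2)) ^ 8 = (theta_A 1 n) ^ 4"
proof -
  define q where "q = exp (- pi * sqrt n)"
  have q: "0 < q" "q < 1" using assms by (simp_all add: q_def)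
  then have q2: "0 < q\<^sup>2" "q\<^sup>2 < 1" by (simp_all add: power_less_one_iff)
  \<comment> \<open>This halving cancels the 2 in the exponent of the nome of
    \<open>theta_h'\<close>, so both quantities share \<open>q\<close>.\<close>
  have "sqrt (n / 2 / 2) = sqrt n / 2" by (simp add: real_sqrt_divide)
  then have q': "exp (- 2 * pi * sqrt (n / 2 / 2)) = q" by (simp add: q_def)
  have "theta_h' 2 (n / 2) ^ 8 = ramanujan_phi (- q) ^ 8 / (4 * ramanujan_phi (- q\<^sup>2) ^ 8)"
  proof -
    have "((2::real) powr (1 / 4)) ^ 8 = 4" by (simp add: powr_power)
    then show ?thesis
      unfolding theta_h'_def q' Let_def using q by (simp add: power_divide power_mult_distrib)
  qed
  moreover have "theta_A 1 n ^ 4 = ramanujan_phi (- q) ^ 4 / (16 * q * ramanujan_psi (q\<^sup>2) ^ 4)"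
  proof -
    have "exp (- pi * sqrt (n / 1)) = q" by (simp add: q_def)
    \<comment> \<open>The fourth power of \<open>2 * q powr (1 / 4)\<close> is the factor
      \<open>16 * q\<close> of Jacobi's identity.\<close>
    moreover have "(q powr (1 / 4)) ^ 4 = q" using q by (simp add: powr_power)
    ultimately show ?thesis
      unfolding theta_A_def using q
      by (simp add: Let_def power_divide power_mult_distrib)
  qed
  moreover have "ramanujan_phi q \<noteq> 0" "ramanujan_psi (q\<^sup>2) \<noteq> 0"
    using ramanujan_phi_pos[OF q] ramanujan_psi_pos[OF q2] by simp_all
  ultimately show ?thesis
    using theta_h'_theta_A_identity[OF phi_times_phi_minus jacobi_phi_psi, of q] q by simp
qed

end
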